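(* For every $b>1$ there exists a sequence of unit-weight instances $(\vec p_i)_{i\in\mathbb{N}}$ for single-machine scheduling minimizing $\sum_jC_j$ such that $$\frac{\mathbb{E}[R_b(\vec p_i)]}{\mathrm{OPT}(\vec p_i)}\xrightarrow{i\to\infty}\frac{\sqrt b+2b-1}{\sqrt b\,\log b},$$ where $\log$ is the natural logarithm.
   Context: Instances consist of $n$ jobs with processing times $p_j>0$ and unit weights on a single machine; objective $\sum_j C_j$; $\mathrm{OPT}$ is the optimal clairvoyant objective value (processing in nondecreasing order of $p_j$). Kill-and-restart model: a probing of $j$ for time $\tau$ completes $j$ after $p_j$ time units if $\tau\geq p_j$, otherwise it is aborted after $\tau$ time units and all progress is lost. For a permutation $\sigma$ of $[n]$ and $\xi\in[0,1]$, $D_b^{\sigma,\xi}$ proceeds in rounds $q\in\mathbb{Z}$ in increasing order from $-\infty$; in round $q$ every unfinished job is probed, in the order given by $\sigma$, for time $b^{q+\xi}$; probings run back to back from time $0$ without idling (limit as $q_0\to-\infty$ of the algorithm starting in round $q_0$). $R_b:=D_b^{\Sigma,\Xi}$ with $\Sigma$ a uniformly random permutation and $\Xi$ uniform on $[0,1]$, independent; $R_b(\vec p)$ is its (random) objective value. *)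

theory Defs
  imports "HOL-Probability.Probability" "HOL-Combinatorics.Multiset_Permutations"
begin

text \<open>An instance is the list of its processing times; the jobs are the indices
  \<open>0, \<dots>, length p - 1\<close>. All weights are one.\<close>

definition is_instance :: "real list \<Rightarrow> bool" where
  "is_instance p \<longleftrightarrow> p \<noteq> [] \<and> (\<forall>x\<in>set p. 0 < x)"

subsection \<open>The clairvoyant optimum\<close>

text \<open>A schedule assigns to each job the start of its uninterrupted run. Idle time is allowed, so
  aborted probings, which are useless to a clairvoyant scheduler, are covered as well.\<close>

definition feasible :: "real list \<Rightarrow> (nat \<Rightarrow> real) \<Rightarrow> bool" where
  "feasible p S \<longleftrightarrow>
     (\<forall>j<length p. 0 \<le> S j) \<and>
     (\<forall>i<length p. \<forall>j<length p. i \<noteq> j \<longrightarrow> {S i..<S i + p ! i} \<inter> {S j..<S j + p ! j} = {})"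

definition OPT :: "real list \<Rightarrow> real" where
  "OPT p = (INF S\<in>Collect (feasible p). \<Sum>j<length p. S j + p ! j)"

subsection \<open>The kill-and-restart algorithm\<close>

text \<open>A state consists of the current time and the completion times of the finished jobs.\<close>

type_synonym state = "real \<times> (nat \<Rightarrow> real option)"

fun probe :: "real list \<Rightarrow> real \<Rightarrow> nat \<Rightarrow> state \<Rightarrow> state" where
  "probe p \<tau> j (t, C) =
     (if C j \<noteq> None then (t, C)
      else if p ! j \<le> \<tau> then (t + p ! j, C(j \<mapsto> t + p ! j))
      else (t + \<tau>, C))"

text \<open>A permutation of the jobs is given as the list \<open>\<sigma>\<close> of the jobs in probing order.
  The term \<open>run b \<sigma> \<xi> p q\<^sub>0 m\<close> is the state reached after the \<open>m\<close> rounds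
  \<open>q\<^sub>0, \<dots>, q\<^sub>0 + m - 1\<close>.\<close>

primrec run :: "real \<Rightarrow> nat list \<Rightarrow> real \<Rightarrow> real list \<Rightarrow> int \<Rightarrow> nat \<Rightarrow> state" where
  "run b \<sigma> \<xi> p q0 0 = (0, Map.empty)"
| "run b \<sigma> \<xi> p q0 (Suc m) =
     fold (probe p (b powr (of_int (q0 + int m) + \<xi>))) \<sigma> (run b \<sigma> \<xi> p q0 m)"

definition completion_from :: "real \<Rightarrow> nat list \<Rightarrow> real \<Rightarrow> real list \<Rightarrow> int \<Rightarrow> nat \<Rightarrow> real" where
  "completion_from b \<sigma> \<xi> p q0 j = (THE c. \<exists>m. snd (run b \<sigma> \<xi> p q0 m) j = Some c)"

definition completion :: "real \<Rightarrow> nat list \<Rightarrow> real \<Rightarrow> real list \<Rightarrow> nat \<Rightarrow> real" where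
  "completion b \<sigma> \<xi> p j = Lim at_bot (\<lambda>q0. completion_from b \<sigma> \<xi> p q0 j)"

definition D_cost :: "real \<Rightarrow> nat list \<Rightarrow> real \<Rightarrow> real list \<Rightarrow> real" where
  "D_cost b \<sigma> \<xi> p = (\<Sum>j<length p. completion b \<sigma> \<xi> p j)"

text \<open>The joint distribution of the independent \<open>\<Sigma>\<close> and \<open>\<Xi>\<close> for \<open>n\<close> jobs.\<close>

definition choices :: "nat \<Rightarrow> (nat list \<times> real) measure" where
  "choices n = uniform_count_measure (permutations_of_set {..<n})
                 \<Otimes>\<^sub>M uniform_measure lborel {0..1}"

definition R_expected :: "real \<Rightarrow> real list \<Rightarrow> real" where
  "R_expected b p = (\<integral>\<omega>. D_cost b (fst \<omega>) (snd \<omega>) p \<partial>choices (length p))"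

subsection \<open>Processing in nondecreasing order is optimal\<close>

definition list_cost :: "real list \<Rightarrow> real" where
  "list_cost xs = (\<Sum>k<length xs. sum_list (take (Suc k) xs))"

lemma list_cost_Cons: "list_cost (y # ys) = y * (1 + real (length ys)) + list_cost ys"
proof -
  have "list_cost (y # ys) = y + (\<Sum>k<length ys. y + sum_list (take (Suc k) ys))"
    unfolding list_cost_def
    by (simp only: length_Cons sum.lessThan_Suc_shift take_Suc_Cons sum_list.Cons take_0 sum_list.Nil
        add_0_right)
  then show ?thesis
    by (simp add: list_cost_def sum.distrib algebra_simps)
qed

lemma list_cost_Nil [simp]: "list_cost [] = 0"
  by (simp add: list_cost_def)

lemma list_cost_insort:
  "sorted ys \<Longrightarrow> list_cost (insort x ys) \<le> list_cost ys + sum_list ys + x"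
proof (induction ys)
  case (Cons y ys)
  show ?case
  proof (cases "x \<le> y")
    case True
    have "x * real (length zs) \<le> sum_list zs" if "\<forall>z\<in>set zs. x \<le> z" for zs
      using that by (induction zs) (auto simp: algebra_simps)
    moreover have "\<forall>z\<in>set (y # ys). x \<le> z"
      using True Cons.prems by force
    ultimately have "x * real (length (y # ys)) \<le> sum_list (y # ys)"
      by blast
    moreover have "list_cost (insort x (y # ys)) = x * (1 + real (length (y # ys))) + list_cost (y # ys)"
      using True by (simp only: insort_key.simps if_True list_cost_Cons)
    ultimately show ?thesis by (simp add: algebra_simps)
  next
    case False
    then have "list_cost (insort x (y # ys)) = y * (2 + real (length ys)) + list_cost (insort x ys)"
      by (simp only: insort_key.simps if_False list_cost_Cons length_insort of_nat_Suc)
         (simp add: algebra_simps)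
    moreover have "list_cost (insort x ys) \<le> list_cost ys + sum_list ys + x"
      using Cons by simp
    moreover have "sum_list (y # ys) = y + sum_list ys" by simp
    ultimately show ?thesis by (simp only: list_cost_Cons) (simp add: algebra_simps)
  qed
qed (simp add: list_cost_Cons)

lemma last_job:
  fixes S w :: "nat \<Rightarrow> real"
  assumes "finite J" "J \<noteq> {}" "\<forall>j\<in>J. 0 < w j"
    and "\<forall>i\<in>J. \<forall>j\<in>J. i \<noteq> j \<longrightarrow> {S i..<S i + w i} \<inter> {S j..<S j + w j} = {}"
  obtains m where "m \<in> J" "\<forall>j\<in>J - {m}. S j + w j \<le> S m"
proof -
  have "Max ((\<lambda>j. S j + w j) ` J) \<in> (\<lambda>j. S j + w j) ` J"
    using assms by (intro Max_in) auto
  then obtain m where m: "m \<in> J" "Max ((\<lambda>j. S j + w j) ` J) = S m + w m"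
    by auto
  have max: "S j + w j \<le> S m + w m" if "j \<in> J" for j
    using that assms(1) Max_ge[of "(\<lambda>j. S j + w j) ` J" "S j + w j"] m(2) by auto
  have "S j + w j \<le> S m" if j: "j \<in> J - {m}" for j
  proof (rule ccontr)
    assume "\<not> S j + w j \<le> S m"
    then have "max (S j) (S m) \<in> {S j..<S j + w j} \<inter> {S m..<S m + w m}"
      using m(1) max[of j] assms(3) j by (auto simp: max_def not_le)
    then show False using assms(4) m j by blast
  qed
  then show thesis using that m by blast
qed

lemma schedule_length:
  fixes S w :: "nat \<Rightarrow> real"
  assumes "finite J" "\<forall>j\<in>J. 0 < w j" "\<forall>j\<in>J. 0 \<le> S j"
    and "\<forall>i\<in>J. \<forall>j\<in>J. i \<noteq> j \<longrightarrow> {S i..<S i + w i} \<inter> {S j..<S j + w j} = {}"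
    and "0 \<le> T" "\<forall>j\<in>J. S j + w j \<le> T"
  shows "sum w J \<le> T"
  using assms
proof (induction "card J" arbitrary: J T)
  case (Suc n)
  have ne: "J \<noteq> {}" using Suc.hyps(2) by auto
  obtain m where m: "m \<in> J" "\<forall>j\<in>J - {m}. S j + w j \<le> S m"
    by (rule last_job[OF Suc.prems(1) ne Suc.prems(2,4)])
  have "sum w (J - {m}) \<le> S m"
  proof (rule Suc.hyps(1))
    show "n = card (J - {m})" using m(1) Suc.hyps(2) Suc.prems(1) by simp
  qed (use Suc.prems m in auto)
  moreover have "S m + w m \<le> T" using Suc.prems(6) m(1) by blast
  ultimately show ?case using m(1) Suc.prems(1) by (simp add: sum.remove)
qed auto

lemma schedule_lower_bound:
  fixes S w :: "nat \<Rightarrow> real"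
  assumes "finite J" "\<forall>j\<in>J. 0 < w j" "\<forall>j\<in>J. 0 \<le> S j"
    and "\<forall>i\<in>J. \<forall>j\<in>J. i \<noteq> j \<longrightarrow> {S i..<S i + w i} \<inter> {S j..<S j + w j} = {}"
    and "sorted xs" "mset xs = image_mset w (mset_set J)"
  shows "list_cost xs \<le> (\<Sum>j\<in>J. S j + w j)"
  using assms
proof (induction "card J" arbitrary: J xs)
  case (Suc n)
  have ne: "J \<noteq> {}" using Suc.hyps(2) by auto
  obtain m where m: "m \<in> J" "\<forall>j\<in>J - {m}. S j + w j \<le> S m"
    by (rule last_job[OF Suc.prems(1) ne Suc.prems(2,4)])
  define ys where "ys = sorted_list_of_multiset (image_mset w (mset_set (J - {m})))"
  have ys: "sorted ys" "mset ys = image_mset w (mset_set (J - {m}))"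
    unfolding ys_def by simp_all
  have "mset_set J = add_mset m (mset_set (J - {m}))"
    using m(1) Suc.prems(1) by (simp add: mset_set.remove)
  then have "mset xs = mset (insort (w m) ys)"
    using Suc.prems ys by simp
  then have xs: "xs = insort (w m) ys"
    using Suc.prems ys by (metis sorted_insort sorted_sort_id properties_for_sort)
  have "sum_list ys = sum w (J - {m})"
    using ys(2) by (metis sum_mset_sum_list sum_unfold_sum_mset)
  also have "\<dots> \<le> S m"
    using Suc.prems m by (intro schedule_length[of _ w S]) auto
  finally have "list_cost xs \<le> list_cost ys + (S m + w m)"
    using list_cost_insort[OF ys(1), of "w m"] xs by simp
  moreover have "list_cost ys \<le> (\<Sum>j\<in>J - {m}. S j + w j)"
  proof (rule Suc.hyps(1))
    show "n = card (J - {m})" using m(1) Suc.hyps(2) Suc.prems(1) by simp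
  qed (use Suc.prems m ys in auto)
  ultimately show ?case using m(1) Suc.prems(1) by (simp add: sum.remove)
qed (auto simp: mset_set.infinite)

lemma schedule_of_order:
  fixes w :: "nat \<Rightarrow> real"
  assumes "distinct js" "\<forall>j\<in>set js. 0 < w j"
  shows "\<exists>S. (\<forall>j\<in>set js. t \<le> S j) \<and>
           (\<forall>i\<in>set js. \<forall>j\<in>set js. i \<noteq> j \<longrightarrow> {S i..<S i + w i} \<inter> {S j..<S j + w j} = {}) \<and>
           (\<Sum>j\<in>set js. S j + w j) = real (length js) * t + list_cost (map w js)"
  using assms
proof (induction js arbitrary: t)
  case (Cons k js)
  obtain S where S: "\<forall>j\<in>set js. t + w k \<le> S j"
    "\<forall>i\<in>set js. \<forall>j\<in>set js. i \<noteq> j \<longrightarrow> {S i..<S i + w i} \<inter> {S j..<S j + w j} = {}"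
    "(\<Sum>j\<in>set js. S j + w j) = real (length js) * (t + w k) + list_cost (map w js)"
    using Cons.IH[of "t + w k"] Cons.prems by auto
  have k: "k \<notin> set js" "0 < w k" using Cons.prems by auto
  have "(\<Sum>j\<in>set js. (S(k := t)) j + w j) = (\<Sum>j\<in>set js. S j + w j)"
    using k by (intro sum.cong) auto
  then have "(\<Sum>j\<in>set (k # js). (S(k := t)) j + w j) =
      real (length (k # js)) * t + list_cost (map w (k # js))"
    using k S(3) list_cost_Cons[of "w k" "map w js"] by (simp add: algebra_simps)
  moreover have "\<forall>j\<in>set (k # js). t \<le> (S(k := t)) j"
    using S(1) k by force
  moreover have "\<forall>i\<in>set (k # js). \<forall>j\<in>set (k # js). i \<noteq> j \<longrightarrow>
      {(S(k := t)) i..<(S(k := t)) i + w i} \<inter> {(S(k := t)) j..<(S(k := t)) j + w j} = {}"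
  proof (intro ballI impI)
    fix i j assume ij: "i \<in> set (k # js)" "j \<in> set (k # js)" "i \<noteq> j"
    have first: "{t..<t + w k} \<inter> {S j..<S j + w j} = {}" if "j \<in> set js" for j
      using bspec[OF S(1) that] by auto
    consider "i = k" "j \<in> set js" "j \<noteq> k" | "j = k" "i \<in> set js" "i \<noteq> k"
      | "i \<in> set js" "j \<in> set js" "i \<noteq> k" "j \<noteq> k"
      using ij k by auto
    then show "{(S(k := t)) i..<(S(k := t)) i + w i} \<inter> {(S(k := t)) j..<(S(k := t)) j + w j} = {}"
    proof cases
      case 1
      then show ?thesis using first[of j] by simp
    next
      case 2
      then show ?thesis using first[of i] by (simp add: Int_commute)
    next
      case 3
      then show ?thesis using S(2) ij(3) by simp
    qed
  qed
  ultimately show ?case by blast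
qed auto

lemma OPT_eq_nondecreasing_order:
  assumes "is_instance p"
  shows "OPT p = (\<Sum>k<length p. sum_list (take (Suc k) (sort p)))"
proof -
  have pos: "\<forall>j\<in>{..<length p}. 0 < p ! j"
    using assms by (auto simp: is_instance_def)
  have p: "image_mset ((!) p) (mset_set {..<length p}) = mset p"
    by (metis map_nth mset_map mset_upt atLeast0LessThan)
  have lower: "list_cost (sort p) \<le> (\<Sum>j<length p. S j + p ! j)" if "feasible p S" for S
    using that pos p by (intro schedule_lower_bound) (auto simp: feasible_def)
  define js where "js = sort_key ((!) p) [0..<length p]"
  have js: "set js = {..<length p}" "distinct js" "map ((!) p) js = sort p"
  proof -
    show "set js = {..<length p}" "distinct js" by (auto simp: js_def)
    have "mset (map ((!) p) js) = mset p"
      unfolding js_def by (metis map_nth mset_map mset_sort)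
    moreover have "sorted (map ((!) p) js)" by (simp add: js_def)
    ultimately show "map ((!) p) js = sort p" by (metis properties_for_sort)
  qed
  obtain S where S: "\<forall>j<length p. 0 \<le> S j"
    "\<forall>i<length p. \<forall>j<length p. i \<noteq> j \<longrightarrow> {S i..<S i + p ! i} \<inter> {S j..<S j + p ! j} = {}"
    "(\<Sum>j<length p. S j + p ! j) = list_cost (sort p)"
    using schedule_of_order[of js "(!) p" 0, unfolded js] pos js(2)
    by (simp add: Ball_def lessThan_iff) blast
  then have "OPT p = list_cost (sort p)"
    unfolding OPT_def using lower
    by (intro cInf_eq_minimum) (auto simp: feasible_def intro!: image_eqI[of _ _ S])
  then show ?thesis by (simp add: list_cost_def)
qed

end

(* The instances consist of the jobs 1/k^2 for k = 1, ..., n, so that OPT is the harmonic number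
   H_n. Averaging over sigma and its reversal replaces each relative order of two jobs by 1/2;
   averaging over xi makes log_b of (probing time of the final round / p_j) uniform on [0,1).
   A pair of jobs with p_j <= p_k thus contributes p_j * g(log_b (p_k / p_j)) for an explicit
   increasing function g. The contribution of job k is therefore 1/k times a Riemann sum of
   u |-> g(log_b (u^-2)) over [0,1] with step 1/k (plus a vanishing term), and the ratio to OPT is
   the weighted mean of these Riemann sums with weights 1/k. Since the harmonic series diverges,
   it converges to the integral of g(log_b (u^-2)). *)

theory Submission
  imports Defs
begin

section \<open>Completion times for fixed \<open>\<sigma>\<close> and \<open>\<xi>\<close>\<close>

definition probe_time :: "real \<Rightarrow> real \<Rightarrow> int \<Rightarrow> real" where
  "probe_time b \<xi> q = b powr (of_int q + \<xi>)"

text \<open>For \<open>b > 1\<close> and \<open>x > 0\<close> this is the least \<open>q\<close>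
  with \<open>x \<le> probe_time b \<xi> q\<close>: a job of size \<open>x\<close> completes in a
  round that depends on \<open>\<xi>\<close> but not on \<open>\<sigma>\<close>.\<close>

definition final_round :: "real \<Rightarrow> real \<Rightarrow> real \<Rightarrow> int" where
  "final_round b \<xi> x = \<lceil>log b x - \<xi>\<rceil>"

definition work_in :: "real \<Rightarrow> real \<Rightarrow> real \<Rightarrow> int \<Rightarrow> real" where
  "work_in b \<xi> x q = (if final_round b \<xi> x < q then 0 else min x (probe_time b \<xi> q))"

text \<open>The work on a job in all rounds before \<open>q\<close>: the rounds below \<open>r\<close> that abort it sum to the
  geometric series \<open>b powr (r + \<xi>) / (b - 1)\<close>.\<close>

definition work_before :: "real \<Rightarrow> real \<Rightarrow> real \<Rightarrow> int \<Rightarrow> real" where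
  "work_before b \<xi> x q =
     (if q \<le> final_round b \<xi> x then probe_time b \<xi> q / (b - 1)
      else probe_time b \<xi> (final_round b \<xi> x) / (b - 1) + x)"

definition jobs_before :: "nat list \<Rightarrow> nat \<Rightarrow> nat set" where
  "jobs_before \<sigma> j = set (takeWhile (\<lambda>k. k \<noteq> j) \<sigma>)"

section \<open>Arithmetic of probing times and of the work per round\<close>

lemma probe_time_pos: "b > 1 \<Longrightarrow> probe_time b \<xi> q > 0"
  by (simp add: probe_time_def)

lemma probe_time_add_one: "b > 1 \<Longrightarrow> probe_time b \<xi> (q + 1) = b * probe_time b \<xi> q"
  using powr_add[of b 1 "of_int q + \<xi>"] by (simp add: probe_time_def add_ac)

lemma le_probe_time_iff:
  assumes "b > 1" "x > 0"
  shows "x \<le> probe_time b \<xi> q \<longleftrightarrow> final_round b \<xi> x \<le> q"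
proof -
  have "x \<le> probe_time b \<xi> q \<longleftrightarrow> log b x \<le> of_int q + \<xi>"
    using assms by (simp add: probe_time_def log_le_iff)
  also have "\<dots> \<longleftrightarrow> final_round b \<xi> x \<le> q"
    by (simp add: final_round_def ceiling_le_iff algebra_simps)
  finally show ?thesis .
qed

lemma final_round_mono:
  assumes "b > 1" "0 < x" "x \<le> y"
  shows "final_round b \<xi> x \<le> final_round b \<xi> y"
  using assms by (auto simp: final_round_def intro!: ceiling_mono)

text \<open>Below the final round this is \<open>P + P / (b - 1) = b * P / (b - 1)\<close>; in the
  final round the work is \<open>x\<close> itself. The recurrence makes elapsed times telescope in
  \<open>run_eq\<close>.\<close>

lemma work_before_add_one:
  assumes "b > 1" "x > 0"
  shows "work_before b \<xi> x (q + 1) = work_before b \<xi> x q + work_in b \<xi> x q"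
proof -
  have *: "probe_time b \<xi> q + probe_time b \<xi> q / (b - 1) = probe_time b \<xi> (q + 1) / (b - 1)"
    unfolding probe_time_add_one[OF assms(1)] using assms by (simp add: field_simps)
  consider "final_round b \<xi> x < q" | "final_round b \<xi> x = q" | "q + 1 \<le> final_round b \<xi> x"
    by linarith
  then show ?thesis
  proof cases
    case 2
    then have "x \<le> probe_time b \<xi> q" using le_probe_time_iff[OF assms] by simp
    then show ?thesis using 2 by (simp add: work_before_def work_in_def)
  next
    case 3
    then have "\<not> x \<le> probe_time b \<xi> q" using le_probe_time_iff[OF assms] by simp
    then have "work_in b \<xi> x q = probe_time b \<xi> q" using 3 by (simp add: work_in_def)
    moreover have "work_before b \<xi> x (q + 1) = probe_time b \<xi> (q + 1) / (b - 1)"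
      "work_before b \<xi> x q = probe_time b \<xi> q / (b - 1)"
      using 3 by (simp_all add: work_before_def)
    ultimately show ?thesis using * by linarith
  qed (simp add: work_before_def work_in_def)
qed

text \<open>A probing changes the completion map only at its own job. As no job repeats in
  \<open>\<sigma>\<close>, the map \<open>C\<close> at the start of the round decides which jobs are
  skipped.\<close>

lemma fst_fold_probe:
  assumes "distinct \<sigma>"
  shows "fst (fold (probe p \<tau>) \<sigma> (t, C)) =
           t + (\<Sum>k\<in>set \<sigma>. if C k \<noteq> None then 0 else min (p ! k) \<tau>)"
  using assms
proof (induction \<sigma> arbitrary: t C)
  case (Cons k \<sigma>)
  obtain t' C' where *: "probe p \<tau> k (t, C) = (t', C')" by fastforce
  have "C' i = C i" if "i \<in> set \<sigma>" for i
    using that Cons.prems * by (auto split: if_splits)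
  then have "(\<Sum>i\<in>set \<sigma>. if C' i \<noteq> None then 0 else min (p ! i) \<tau>) =
      (\<Sum>i\<in>set \<sigma>. if C i \<noteq> None then 0 else min (p ! i) \<tau>)"
    by (intro sum.cong) auto
  moreover have "t' = t + (if C k \<noteq> None then 0 else min (p ! k) \<tau>)"
    using * by (auto split: if_splits simp: min_def)
  ultimately show ?case
    using Cons * by (simp del: probe.simps)
qed simp

lemma snd_fold_probe_notin:
  "j \<notin> set \<sigma> \<Longrightarrow> snd (fold (probe p \<tau>) \<sigma> s) j = snd s j"
proof (induction \<sigma> arbitrary: s)
  case (Cons k \<sigma>)
  then show ?case by (cases s) auto
qed simp

lemma snd_fold_probe:
  assumes "distinct \<sigma>" "j \<in> set \<sigma>"
  shows "snd (fold (probe p \<tau>) \<sigma> (t, C)) j =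
           (if C j \<noteq> None then C j
            else if p ! j \<le> \<tau> then
              Some (t + (\<Sum>k\<in>jobs_before \<sigma> j. if C k \<noteq> None then 0 else min (p ! k) \<tau>) + p ! j)
            else None)"
proof -
  obtain xs ys where \<sigma>: "\<sigma> = xs @ j # ys"
    using assms split_list by metis
  have xs: "distinct xs" "j \<notin> set xs" "j \<notin> set ys" using assms \<sigma> by auto
  have before: "jobs_before \<sigma> j = set xs"
    using xs unfolding jobs_before_def \<sigma> by (subst takeWhile_append2) auto
  obtain t' C' where *: "fold (probe p \<tau>) xs (t, C) = (t', C')" by fastforce
  have "C' j = C j"
    using snd_fold_probe_notin[of j xs p \<tau> "(t, C)"] xs * by simp
  moreover have "t' = t + (\<Sum>k\<in>set xs. if C k \<noteq> None then 0 else min (p ! k) \<tau>)"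
    using fst_fold_probe[OF xs(1), of p \<tau> t C] * by simp
  ultimately show ?thesis
    unfolding before using * xs by (auto simp: \<sigma> snd_fold_probe_notin)
qed

text \<open>Invariant over the rounds. The bound on \<open>q0\<close> ensures that no job would
  finish in an omitted round, so the late start saves exactly
  \<open>work_before b \<xi> (p ! k) q0\<close> on each job.\<close>

lemma run_eq:
  assumes b: "b > 1" and pos: "\<forall>x\<in>set p. 0 < x"
    and \<sigma>: "distinct \<sigma>" "set \<sigma> = {..<length p}"
    and q0: "\<forall>k<length p. q0 \<le> final_round b \<xi> (p ! k)"
  defines "c \<equiv> \<lambda>j. (\<Sum>k<length p. work_before b \<xi> (p ! k) (final_round b \<xi> (p ! j))
                        - work_before b \<xi> (p ! k) q0)
             + (\<Sum>k\<in>jobs_before \<sigma> j. work_in b \<xi> (p ! k) (final_round b \<xi> (p ! j))) + p ! j"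
  shows "run b \<sigma> \<xi> p q0 m =
     ((\<Sum>k<length p. work_before b \<xi> (p ! k) (q0 + int m) - work_before b \<xi> (p ! k) q0),
      \<lambda>j. if j < length p \<and> final_round b \<xi> (p ! j) < q0 + int m then Some (c j) else None)"
proof (induction m)
  case 0
  show ?case using q0 by (auto simp: fun_eq_iff) 
next
  case (Suc m)
  define q where "q = q0 + int m"
  define t where "t = (\<Sum>k<length p. work_before b \<xi> (p ! k) q - work_before b \<xi> (p ! k) q0)"
  define C where "C = (\<lambda>j. if j < length p \<and> final_round b \<xi> (p ! j) < q then Some (c j) else None)"
  have run: "run b \<sigma> \<xi> p q0 (Suc m) = fold (probe p (probe_time b \<xi> q)) \<sigma> (t, C)"
    unfolding run.simps Suc t_def C_def q_def probe_time_def ..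
  have w: "(if C k \<noteq> None then 0 else min (p ! k) (probe_time b \<xi> q)) = work_in b \<xi> (p ! k) q"
    if "k < length p" for k
    using that by (simp add: C_def work_in_def)
  have p: "0 < p ! k" if "k < length p" for k using pos that by simp
  have "fst (run b \<sigma> \<xi> p q0 (Suc m)) = t + (\<Sum>k<length p. work_in b \<xi> (p ! k) q)"
    unfolding run fst_fold_probe[OF \<sigma>(1)] \<sigma>(2)
    by (intro arg_cong2[where f = "(+)"] sum.cong refl w) simp
  also have "\<dots> = (\<Sum>k<length p. work_before b \<xi> (p ! k) (q + 1) - work_before b \<xi> (p ! k) q0)"
    unfolding t_def sum.distrib[symmetric]
    by (intro sum.cong refl) (simp add: work_before_add_one[OF b p])
  finally have 1: "fst (run b \<sigma> \<xi> p q0 (Suc m)) = \<dots>" .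
  have 2: "snd (run b \<sigma> \<xi> p q0 (Suc m)) j =
      (if j < length p \<and> final_round b \<xi> (p ! j) < q + 1 then Some (c j) else None)" for j
  proof (cases "j < length p")
    case True
    have sub: "jobs_before \<sigma> j \<subseteq> {..<length p}"
      using \<sigma>(2) set_takeWhileD[of _ _ \<sigma>] unfolding jobs_before_def by blast
    have "(\<Sum>k\<in>jobs_before \<sigma> j. if C k \<noteq> None then 0 else min (p ! k) (probe_time b \<xi> q)) =
        (\<Sum>k\<in>jobs_before \<sigma> j. work_in b \<xi> (p ! k) q)"
      using sub by (intro sum.cong refl w) auto
    moreover have "c j = t + (\<Sum>k\<in>jobs_before \<sigma> j. work_in b \<xi> (p ! k) q) + p ! j"
      if "final_round b \<xi> (p ! j) = q"
      using that by (simp add: c_def t_def)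
    ultimately show ?thesis
      unfolding run using True p[OF True] \<sigma>
      by (subst snd_fold_probe) (auto simp: le_probe_time_iff[OF b] C_def)
  next
    case False
    then show ?thesis unfolding run using \<sigma> by (simp add: snd_fold_probe_notin C_def)
  qed
  from 1 2 show ?case
    by (simp add: prod_eq_iff fun_eq_iff q_def algebra_simps)
qed

text \<open>For early \<open>q0\<close> the completion time misses the limit by one geometric tail
  \<open>probe_time b \<xi> q0 / (b - 1)\<close> per job, which vanishes as \<open>q0\<close> tends
  to minus infinity.\<close>

lemma completion_eq:
  assumes b: "b > 1" and pos: "\<forall>x\<in>set p. 0 < x"
    and \<sigma>: "distinct \<sigma>" "set \<sigma> = {..<length p}" and j: "j < length p"
  shows "completion b \<sigma> \<xi> p j =
      (\<Sum>k<length p. work_before b \<xi> (p ! k) (final_round b \<xi> (p ! j)))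
    + (\<Sum>k\<in>jobs_before \<sigma> j. work_in b \<xi> (p ! k) (final_round b \<xi> (p ! j))) + p ! j"
    (is "_ = ?c")
proof -
  define c where "c = (\<lambda>q0. (\<Sum>k<length p. work_before b \<xi> (p ! k) (final_round b \<xi> (p ! j))
                        - probe_time b \<xi> q0 / (b - 1))
             + (\<Sum>k\<in>jobs_before \<sigma> j. work_in b \<xi> (p ! k) (final_round b \<xi> (p ! j))) + p ! j)"
  define Q where "Q = Min ((\<lambda>k. final_round b \<xi> (p ! k)) ` {..<length p})"
  have from_eq: "completion_from b \<sigma> \<xi> p q0 j = c q0" if "q0 \<le> Q" for q0
  proof -
    have q0: "\<forall>k<length p. q0 \<le> final_round b \<xi> (p ! k)"
      using that j unfolding Q_def by (subst (asm) Min_ge_iff) auto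
    have c: "c q0 = (\<Sum>k<length p. work_before b \<xi> (p ! k) (final_round b \<xi> (p ! j))
                        - work_before b \<xi> (p ! k) q0)
             + (\<Sum>k\<in>jobs_before \<sigma> j. work_in b \<xi> (p ! k) (final_round b \<xi> (p ! j))) + p ! j"
      using q0 by (simp add: c_def work_before_def)
    show ?thesis
      unfolding completion_from_def run_eq[OF b pos \<sigma> q0] c snd_conv
    proof (rule the_equality)
      show "\<exists>m. (if j < length p \<and> final_round b \<xi> (p ! j) < q0 + int m then Some
          ((\<Sum>k<length p. work_before b \<xi> (p ! k) (final_round b \<xi> (p ! j))
                        - work_before b \<xi> (p ! k) q0)
             + (\<Sum>k\<in>jobs_before \<sigma> j. work_in b \<xi> (p ! k) (final_round b \<xi> (p ! j))) + p ! j)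
           else None) = Some
          ((\<Sum>k<length p. work_before b \<xi> (p ! k) (final_round b \<xi> (p ! j))
                        - work_before b \<xi> (p ! k) q0)
             + (\<Sum>k\<in>jobs_before \<sigma> j. work_in b \<xi> (p ! k) (final_round b \<xi> (p ! j))) + p ! j)"
        \<comment> \<open>The witness counts the rounds from \<open>q0\<close> up to and including
          the final round of \<open>j\<close>.\<close>
        using j by (intro exI[of _ "nat (final_round b \<xi> (p ! j) - q0 + 1)"]) auto
    qed (auto split: if_splits)
  qed
  have "((\<lambda>q0. probe_time b \<xi> q0) \<longlongrightarrow> 0) at_bot"
  proof -
    have "((\<lambda>x::real. b powr (x + \<xi>)) \<longlongrightarrow> 0) at_bot"
      using b by real_asymp
    moreover have "filterlim (\<lambda>q::int. real_of_int q) at_bot at_bot"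
      unfolding filterlim_at_bot eventually_at_bot_linorder by (metis le_floor_iff)
    ultimately show ?thesis unfolding probe_time_def by (rule filterlim_compose)
  qed
  then have "((\<lambda>q0. probe_time b \<xi> q0 / (b - 1)) \<longlongrightarrow> 0) at_bot"
    using b by (auto intro: tendsto_divide_zero)
  then have "(c \<longlongrightarrow> (\<Sum>k<length p. work_before b \<xi> (p ! k) (final_round b \<xi> (p ! j)) - 0)
    + (\<Sum>k\<in>jobs_before \<sigma> j. work_in b \<xi> (p ! k) (final_round b \<xi> (p ! j))) + p ! j) at_bot"
    unfolding c_def by (intro tendsto_intros)
  then have "(c \<longlongrightarrow> ?c) at_bot" by simp
  moreover have "\<forall>\<^sub>F q0 in at_bot. c q0 = completion_from b \<sigma> \<xi> p q0 j"
    unfolding eventually_at_bot_linorder using from_eq by (intro exI[of _ Q]) simp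
  ultimately have "((\<lambda>q0. completion_from b \<sigma> \<xi> p q0 j) \<longlongrightarrow> ?c) at_bot"
    by (rule Lim_transform_eventually)
  then show ?thesis
    unfolding completion_def by (intro tendsto_Lim) simp_all
qed

section \<open>Averaging over \<open>\<Sigma>\<close> and \<open>\<Xi>\<close>\<close>

text \<open>The average of \<open>D_cost\<close> over a probing order and its reversal, hence the factor \<open>1 / 2\<close>.\<close>

definition mean_cost :: "real \<Rightarrow> real \<Rightarrow> real list \<Rightarrow> real" where
  "mean_cost b \<xi> p = (\<Sum>j<length p.
     (\<Sum>k<length p. work_before b \<xi> (p ! k) (final_round b \<xi> (p ! j)))
   + (\<Sum>k\<in>{..<length p} - {j}. work_in b \<xi> (p ! k) (final_round b \<xi> (p ! j))) / 2 + p ! j)"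

lemma jobs_before_rev:
  assumes "distinct \<sigma>" "j \<in> set \<sigma>"
  shows "jobs_before \<sigma> j \<union> jobs_before (rev \<sigma>) j = set \<sigma> - {j}"
    and "jobs_before \<sigma> j \<inter> jobs_before (rev \<sigma>) j = {}"
proof -
  obtain xs ys where \<sigma>: "\<sigma> = xs @ j # ys"
    using assms split_list by metis
  have xs: "j \<notin> set xs" "j \<notin> set ys" "set xs \<inter> set ys = {}" using assms \<sigma> by auto
  have 1: "jobs_before \<sigma> j = set xs"
    using xs unfolding jobs_before_def \<sigma> by (subst takeWhile_append2) auto
  have 2: "jobs_before (rev \<sigma>) j = set ys"
    using xs unfolding jobs_before_def \<sigma> rev_append rev.simps append_assoc
    by (subst takeWhile_append2) auto
  show "jobs_before \<sigma> j \<union> jobs_before (rev \<sigma>) j = set \<sigma> - {j}"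
    unfolding 1 2 using xs \<sigma> by auto
  show "jobs_before \<sigma> j \<inter> jobs_before (rev \<sigma>) j = {}"
    unfolding 1 2 using xs by auto
qed

text \<open>Only the sum over \<open>jobs_before\<close> depends on the order, and each job other
  than \<open>j\<close> precedes \<open>j\<close> in exactly one of the two orders.\<close>

lemma D_cost_rev:
  assumes b: "b > 1" and pos: "\<forall>x\<in>set p. 0 < x"
    and \<sigma>: "distinct \<sigma>" "set \<sigma> = {..<length p}"
  shows "D_cost b \<sigma> \<xi> p + D_cost b (rev \<sigma>) \<xi> p = 2 * mean_cost b \<xi> p"
proof -
  have rev: "distinct (rev \<sigma>)" "set (rev \<sigma>) = {..<length p}" using \<sigma> by auto
  have *: "completion b \<sigma> \<xi> p j + completion b (rev \<sigma>) \<xi> p j =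
      2 * ((\<Sum>k<length p. work_before b \<xi> (p ! k) (final_round b \<xi> (p ! j)))
   + (\<Sum>k\<in>{..<length p} - {j}. work_in b \<xi> (p ! k) (final_round b \<xi> (p ! j))) / 2 + p ! j)"
    if j: "j < length p" for j
  proof -
    have j': "j \<in> set \<sigma>" using j \<sigma> by simp
    have fin: "finite (jobs_before \<sigma> j)" "finite (jobs_before (rev \<sigma>) j)"
      by (simp_all add: jobs_before_def)
    have "(\<Sum>k\<in>{..<length p} - {j}. work_in b \<xi> (p ! k) (final_round b \<xi> (p ! j))) =
       (\<Sum>k\<in>jobs_before \<sigma> j. work_in b \<xi> (p ! k) (final_round b \<xi> (p ! j))) +
       (\<Sum>k\<in>jobs_before (rev \<sigma>) j. work_in b \<xi> (p ! k) (final_round b \<xi> (p ! j)))"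
      using jobs_before_rev[OF \<sigma>(1) j'] sum.union_disjoint[OF fin] \<sigma>(2) by metis
    then show ?thesis
      by (simp add: completion_eq[OF b pos \<sigma> j] completion_eq[OF b pos rev j])
  qed
  show ?thesis
    unfolding D_cost_def mean_cost_def sum.distrib[symmetric] sum_distrib_left
    by (intro sum.cong refl *) simp
qed

text \<open>Reversal is an involution of the permutations, so pairing orders with their reversals
  yields the average without computing the probability that one job precedes another.\<close>

lemma sum_D_cost:
  assumes b: "b > 1" and pos: "\<forall>x\<in>set p. 0 < x"
  defines "P \<equiv> permutations_of_set {..<length p}"
  shows "(\<Sum>\<sigma>\<in>P. D_cost b \<sigma> \<xi> p) = real (card P) * mean_cost b \<xi> p"
proof -
  have "(\<Sum>\<sigma>\<in>P. D_cost b (rev \<sigma>) \<xi> p) = (\<Sum>\<sigma>\<in>P. D_cost b \<sigma> \<xi> p)"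
    by (rule sum.reindex_bij_witness[of _ rev rev])
       (auto simp: P_def permutations_of_set_def)
  then have "2 * (\<Sum>\<sigma>\<in>P. D_cost b \<sigma> \<xi> p) = (\<Sum>\<sigma>\<in>P. D_cost b \<sigma> \<xi> p + D_cost b (rev \<sigma>) \<xi> p)"
    by (simp add: sum.distrib)
  also have "\<dots> = (\<Sum>\<sigma>\<in>P. 2 * mean_cost b \<xi> p)"
    using b pos by (intro sum.cong refl D_cost_rev) (auto simp: P_def permutations_of_set_def)
  finally show ?thesis by simp
qed

text \<open>Rounding \<open>log b x - \<xi>\<close> up adds \<open>frac (\<xi> - log b x)\<close>,
  which is again uniform for uniform \<open>\<xi>\<close>; \<open>has_integral_frac_shift\<close>
  exploits this.\<close>

lemma probe_time_final_round:
  assumes "b > 1" "x > 0"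
  shows "probe_time b \<xi> (final_round b \<xi> x) = x * b powr frac (\<xi> - log b x)"
proof -
  have "of_int (final_round b \<xi> x) + \<xi> = log b x + frac (\<xi> - log b x)"
    by (simp add: final_round_def ceiling_def frac_def)
  then show ?thesis
    using assms by (simp add: probe_time_def powr_add)
qed

section \<open>Bounds uniform in \<open>\<xi>\<close>, and measurability\<close>

lemma probe_time_final_round_le:
  assumes "b > 1" "x > 0"
  shows "probe_time b \<xi> (final_round b \<xi> x) \<le> x * b"
proof -
  have "b powr frac (\<xi> - log b x) \<le> b powr 1"
    using assms frac_lt_1[of "\<xi> - log b x"] by (intro powr_mono) auto
  then show ?thesis using assms by (simp add: probe_time_final_round)
qed

lemma work_in_bounds:
  assumes "b > 1" "x > 0"
  shows "0 \<le> work_in b \<xi> x q" "work_in b \<xi> x q \<le> x"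
  using assms probe_time_pos[of b \<xi> q] by (auto simp: work_in_def)

lemma work_before_bounds:
  assumes "b > 1" "x > 0"
  shows "0 \<le> work_before b \<xi> x q" "work_before b \<xi> x q \<le> x * b / (b - 1) + x"
proof -
  let ?Q = "final_round b \<xi> x"
  have "probe_time b \<xi> q \<le> probe_time b \<xi> ?Q" if "q \<le> ?Q"
    using that assms by (simp add: probe_time_def)
  then have "probe_time b \<xi> q / (b - 1) \<le> x * b / (b - 1)" if "q \<le> ?Q"
    using that assms probe_time_final_round_le[OF assms, of \<xi>] by (intro divide_right_mono) auto
  moreover have "probe_time b \<xi> ?Q / (b - 1) \<le> x * b / (b - 1)"
    using assms probe_time_final_round_le[OF assms, of \<xi>] by (intro divide_right_mono) auto
  moreover have "0 \<le> probe_time b \<xi> r / (b - 1)" for r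
    using assms probe_time_pos[of b \<xi> r] by auto
  ultimately show "0 \<le> work_before b \<xi> x q" "work_before b \<xi> x q \<le> x * b / (b - 1) + x"
    using assms by (auto simp: work_before_def add_increasing2)
qed

lemma measurable_final_round [measurable]:
  "(\<lambda>\<xi>. final_round b \<xi> x) \<in> measurable borel (count_space UNIV)"
  unfolding final_round_def by measurable

lemma measurable_probe_time [measurable]:
  assumes [measurable]: "q \<in> measurable borel (count_space UNIV)"
  shows "(\<lambda>\<xi>. probe_time b \<xi> (q \<xi>)) \<in> borel_measurable borel"
  unfolding probe_time_def by measurable

lemma measurable_work_in [measurable]:
  assumes [measurable]: "q \<in> measurable borel (count_space UNIV)"
  shows "(\<lambda>\<xi>. work_in b \<xi> x (q \<xi>)) \<in> borel_measurable borel"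
  unfolding work_in_def by measurable

lemma measurable_work_before [measurable]:
  assumes [measurable]: "q \<in> measurable borel (count_space UNIV)"
  shows "(\<lambda>\<xi>. work_before b \<xi> x (q \<xi>)) \<in> borel_measurable borel"
  unfolding work_before_def by measurable

lemma measurable_mean_cost [measurable]:
  "(\<lambda>\<xi>. mean_cost b \<xi> p) \<in> borel_measurable borel"
  unfolding mean_cost_def by measurable

text \<open>Completion times are defined by a limit; measurability is read off from their closed
  form.\<close>

lemma measurable_D_cost:
  assumes "b > 1" "\<forall>x\<in>set p. 0 < x" "distinct \<sigma>" "set \<sigma> = {..<length p}"
  shows "(\<lambda>\<xi>. D_cost b \<sigma> \<xi> p) \<in> borel_measurable borel"
proof -
  have "(\<lambda>\<xi>. completion b \<sigma> \<xi> p j) \<in> borel_measurable borel" if "j < length p" for j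
    unfolding completion_eq[OF assms that] by measurable
  then show ?thesis
    unfolding D_cost_def by (intro borel_measurable_sum) auto
qed

lemma D_cost_nonneg:
  assumes "b > 1" "\<forall>x\<in>set p. 0 < x" "distinct \<sigma>" "set \<sigma> = {..<length p}"
  shows "0 \<le> D_cost b \<sigma> \<xi> p"
proof -
  have p: "0 < p ! k" if "k < length p" for k using assms(2) that by simp
  have sub: "k < length p" if "k \<in> jobs_before \<sigma> j" for j k
    using that assms(4) set_takeWhileD unfolding jobs_before_def by fastforce
  have "0 \<le> completion b \<sigma> \<xi> p j" if j: "j < length p" for j
    unfolding completion_eq[OF assms j] using sub p[OF j]
    by (intro add_nonneg_nonneg sum_nonneg work_in_bounds work_before_bounds assms(1) p) auto
  then show ?thesis
    unfolding D_cost_def by (intro sum_nonneg) auto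
qed

lemma mean_cost_le:
  assumes b: "b > 1" and pos: "\<forall>x\<in>set p. 0 < x"
  shows "mean_cost b \<xi> p \<le> (\<Sum>j<length p.
     (\<Sum>k<length p. p ! k * b / (b - 1) + p ! k) + (\<Sum>k\<in>{..<length p} - {j}. p ! k) / 2 + p ! j)"
  unfolding mean_cost_def using pos
  by (intro sum_mono add_mono divide_right_mono work_in_bounds work_before_bounds b) auto

lemma uniform_measure_unit_interval:
  "uniform_measure lborel {0..1::real} = density lborel (\<lambda>x. ennreal (indicator {0..1} x))"
  unfolding uniform_measure_def by (simp add: ennreal_indicator divide_ennreal_def)

lemma prob_space_unit_interval: "prob_space (uniform_measure lborel {0..1::real})"
  by (rule prob_space_uniform_measure) auto

text \<open>Bridge from the Henstock-Kurzweil to the Lebesgue integral: boundedness and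
  measurability give integrability, and then both agree.\<close>

lemma integral_unit_interval:
  fixes f :: "real \<Rightarrow> real"
  assumes "f \<in> borel_measurable borel" "\<And>x. 0 \<le> f x" "\<And>x. f x \<le> B"
    and I: "(f has_integral I) {0..1}"
  shows "(\<integral>x. f x \<partial>uniform_measure lborel {0..1}) = I"
proof -
  interpret prob_space "uniform_measure lborel {0..1::real}"
    by (rule prob_space_unit_interval)
  have "integrable (uniform_measure lborel {0..1}) f"
    using assms by (intro integrable_const_bound[of _ B]) auto
  then have "set_integrable lborel {0..1} f"
    unfolding uniform_measure_unit_interval set_integrable_def
    using assms(1) by (subst (asm) integrable_density) auto
  then have "(LINT x:{0..1}|lborel. f x) = I"
    using I by (metis set_borel_integral_eq_integral(2) integral_unique)
  then show ?thesis
    unfolding uniform_measure_unit_interval set_lebesgue_integral_def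
    using assms(1) by (subst integral_density) auto
qed

text \<open>Fubini: the inner average over finitely many orders is \<open>mean_cost\<close> by
  \<open>sum_D_cost\<close>, so a single integral over \<open>\<xi>\<close> remains.\<close>

lemma R_expected_eq:
  assumes b: "b > 1" and pos: "\<forall>x\<in>set p. 0 < x"
    and I: "((\<lambda>\<xi>. mean_cost b \<xi> p) has_integral I) {0..1}"
  shows "R_expected b p = I"
proof -
  define P where "P = permutations_of_set {..<length p}"
  have P: "finite P" "P \<noteq> {}" by (simp_all add: P_def)
  have perm: "distinct \<sigma>" "set \<sigma> = {..<length p}" if "\<sigma> \<in> P" for \<sigma>
    using that by (auto simp: P_def permutations_of_set_def)
  define M where "M = (\<Sum>j<length p.
     (\<Sum>k<length p. p ! k * b / (b - 1) + p ! k) + (\<Sum>k\<in>{..<length p} - {j}. p ! k) / 2 + p ! j)"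
  let ?U = "uniform_count_measure P" and ?V = "uniform_measure lborel {0..1::real}"
  interpret U: prob_space ?U using P by (rule prob_space_uniform_count_measure)
  interpret V: prob_space ?V by (rule prob_space_unit_interval)
  interpret UV: pair_prob_space ?U ?V ..
  \<comment> \<open>Both costs are nonnegative, so each is at most their sum
    \<open>2 * mean_cost b \<xi> p\<close>.\<close>
  have D: "0 \<le> D_cost b \<sigma> \<xi> p" "D_cost b \<sigma> \<xi> p \<le> 2 * M" if "\<sigma> \<in> P" for \<sigma> \<xi>
  proof -
    show "0 \<le> D_cost b \<sigma> \<xi> p" using perm[OF that] by (intro D_cost_nonneg b pos) auto
    have "0 \<le> D_cost b (rev \<sigma>) \<xi> p" using perm[OF that] by (intro D_cost_nonneg b pos) auto
    then show "D_cost b \<sigma> \<xi> p \<le> 2 * M"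
      using D_cost_rev[OF b pos perm[OF that], of \<xi>] mean_cost_le[OF b pos, of \<xi>]
      unfolding M_def by linarith
  qed
  \<comment> \<open>As \<open>P\<close> is finite, joint measurability reduces to measurability in
    \<open>\<xi>\<close> for each order.\<close>
  have "(\<lambda>\<omega>. D_cost b (fst \<omega>) (snd \<omega>) p) \<in> borel_measurable (count_space P \<Otimes>\<^sub>M borel)"
    using P by (intro measurable_pair_measure_countable1)
      (auto simp: countable_finite intro!: measurable_D_cost b pos perm)
  also have "\<dots> = borel_measurable (?U \<Otimes>\<^sub>M ?V)"
    by (intro measurable_cong_sets sets_pair_measure_cong)
      (simp_all add: sets_uniform_count_measure)
  finally have "integrable (?U \<Otimes>\<^sub>M ?V) (\<lambda>\<omega>. D_cost b (fst \<omega>) (snd \<omega>) p)"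
    using D by (intro UV.P.integrable_const_bound[of _ "2 * M"] AE_I2)
      (auto simp: space_pair_measure space_uniform_count_measure)
  then have "R_expected b p = (\<integral>\<xi>. (\<integral>\<sigma>. D_cost b \<sigma> \<xi> p \<partial>?U) \<partial>?V)"
    unfolding R_expected_def choices_def P_def[symmetric]
    by (subst UV.integral_snd) (simp_all add: case_prod_unfold)
  also have "\<dots> = (\<integral>\<xi>. mean_cost b \<xi> p \<partial>?V)"
    using P sum_D_cost[OF b pos] by (simp add: integral_uniform_count_measure P_def)
  also have "\<dots> = I"
  proof (rule integral_unit_interval[OF measurable_mean_cost _ _ I])
    obtain \<sigma> where \<sigma>: "\<sigma> \<in> P" using P by blast
    show "0 \<le> mean_cost b \<xi> p" for \<xi>
      using D_cost_rev[OF b pos perm[OF \<sigma>], of \<xi>] D(1)[OF \<sigma>, of \<xi>]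
        D_cost_nonneg[OF b pos, of "rev \<sigma>" \<xi>] perm[OF \<sigma>] by auto
    show "mean_cost b \<xi> p \<le> M" for \<xi>
      using mean_cost_le[OF b pos] by (simp add: M_def)
  qed
  finally show ?thesis .
qed

section \<open>The contribution of a pair of jobs\<close>

text \<open>A rotation of the circle: \<open>[0, 1 - \<theta>)\<close> moves to
  \<open>[\<theta>, 1)\<close> and \<open>[1 - \<theta>, 1)\<close> to
  \<open>[0, \<theta>)\<close>.\<close>

lemma has_integral_frac_shift:
  fixes F :: "real \<Rightarrow> real"
  assumes "(F has_integral I) {0..1}"
  shows "((\<lambda>\<xi>. F (frac (\<xi> - c))) has_integral I) {0..1}"
proof -
  define \<theta> where "\<theta> = frac (- c)"
  have \<theta>: "0 \<le> \<theta>" "\<theta> < 1" by (simp_all add: \<theta>_def frac_lt_1)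
  have F: "F integrable_on {0..1}" using assms by blast
  define I1 where "I1 = integral {0..\<theta>} F"
  define I2 where "I2 = integral {\<theta>..1} F"
  have I1: "(F has_integral I1) {0..\<theta>}" and I2: "(F has_integral I2) {\<theta>..1}"
    unfolding I1_def I2_def using \<theta>
    by (auto intro!: integrable_integral integrable_subinterval_real[OF F])
  have I: "I = I2 + I1"
    using has_integral_unique[OF assms has_integral_combine[OF _ _ I1 I2]] \<theta> by simp
  have int: "- c - \<theta> \<in> \<int>"
    by (simp add: \<theta>_def frac_def)
  have frac_eq: "frac (\<xi> - c) = \<xi> + \<theta>" if "0 \<le> \<xi>" "\<xi> < 1 - \<theta>" for \<xi>
    using that \<theta> int by (simp add: frac_unique_iff)
  have frac_eq': "frac (\<xi> - c) = \<xi> + (\<theta> - 1)" if "1 - \<theta> \<le> \<xi>" "\<xi> < 1" for \<xi>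
  proof -
    have "- c - \<theta> + 1 \<in> \<int>" using int by (rule Ints_add) simp
    moreover have "\<xi> - c - (\<xi> + (\<theta> - 1)) = - c - \<theta> + 1" by simp
    ultimately have "\<xi> - c - (\<xi> + (\<theta> - 1)) \<in> \<int>" by metis
    then show ?thesis
      unfolding frac_unique_iff using that \<theta> by linarith
  qed
  have "((\<lambda>\<xi>. F (\<xi> + \<theta>)) has_integral I2) {0..1 - \<theta>}"
    using has_integral_affinity'[of F I2 \<theta> 1 1 \<theta>] I2 by simp
  \<comment> \<open>At the right endpoint \<open>frac\<close> jumps to 0 while
    \<open>\<xi> + \<theta>\<close> is 1, so that point is excepted.\<close>
  then have "((\<lambda>\<xi>. F (frac (\<xi> - c))) has_integral I2) {0..1 - \<theta>}"
    by (rule has_integral_spike_finite[of "{1 - \<theta>}", rotated 2]) (auto simp: frac_eq)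
  moreover have "((\<lambda>\<xi>. F (\<xi> + (\<theta> - 1))) has_integral I1) {1 - \<theta>..1}"
    using has_integral_affinity'[of F I1 0 \<theta> 1 "\<theta> - 1"] I1 by simp
  then have "((\<lambda>\<xi>. F (frac (\<xi> - c))) has_integral I1) {1 - \<theta>..1}"
    by (rule has_integral_spike_finite[of "{1}", rotated 2]) (auto simp: frac_eq')
  ultimately show ?thesis
    unfolding I using \<theta> by (intro has_integral_combine) auto
qed

text \<open>Closed form of the integral in \<open>has_integral_growth\<close>, with \<open>s\<close>
  the base-\<open>b\<close> logarithm of the ratio of two sizes. It is constant from
  \<open>s = 1\<close> on because a final probing time overshoots the size by a factor below
  \<open>b\<close>.\<close>

definition growth_integral :: "real \<Rightarrow> real \<Rightarrow> real" where
  "growth_integral b s =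
     (if s \<ge> 1 then 1 + (b - 1) / ln b else s + (b powr s - 1) / ln b + (1 - s) * b powr s)"

lemma has_integral_powr:
  fixes b s t :: real
  assumes "b > 1" "s \<le> t"
  shows "((\<lambda>u. b powr u) has_integral (b powr t / ln b - b powr s / ln b)) {s..t}"
proof (rule fundamental_theorem_of_calculus[OF assms(2)])
  fix x
  have "((\<lambda>u. b powr u / ln b) has_real_derivative b powr x) (at x)"
    using assms by (auto intro!: derivative_eq_intros)
  then show "((\<lambda>u. b powr u / ln b) has_vector_derivative b powr x) (at x within {s..t})"
    by (simp add: has_real_derivative_iff_has_vector_derivative has_vector_derivative_at_within)
qed

text \<open>For \<open>u < s\<close> the integrand is \<open>1 + b powr u\<close>, for
  \<open>u \<ge> s\<close> the constant \<open>b powr s\<close>.\<close>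

lemma has_integral_growth:
  assumes b: "b > 1" and s: "s \<ge> 0"
  shows "((\<lambda>u. (if b powr u < b powr s then 1 else 0) + min (b powr s) (b powr u))
           has_integral growth_integral b s) {0..1}"
    (is "(?f has_integral _) _")
proof -
  have const: "((\<lambda>u. c) has_integral (t - r) * c) {r..t}" if "r \<le> t" for r t c :: real
    using has_integral_const_real[of c r t] that by simp
  have below: "(?f has_integral (t + (b powr t - 1) / ln b)) {0..t}" if "0 \<le> t" "t \<le> s" for t
  proof -
    have "((\<lambda>u. 1 + b powr u) has_integral ((t - 0) * 1 + (b powr t / ln b - b powr 0 / ln b))) {0..t}"
      by (intro has_integral_add const has_integral_powr b that)
    then have "((\<lambda>u. 1 + b powr u) has_integral (t + (b powr t - 1) / ln b)) {0..t}"
      using b by (simp add: diff_divide_distrib)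
    \<comment> \<open>If \<open>t = s\<close>, the strict comparison fails at \<open>u = t\<close>,
      so that endpoint is excepted.\<close>
    then show ?thesis
      by (rule has_integral_spike_finite[of "{t}", rotated 2]) (use that b in \<open>auto simp: min_def\<close>)
  qed
  show ?thesis
  proof (cases "s \<ge> 1")
    case True
    then show ?thesis using below[of 1] b by (simp add: growth_integral_def)
  next
    case False
    have "((\<lambda>u. b powr s) has_integral ((1 - s) * b powr s)) {s..1}"
      using False by (intro const) auto
    then have "(?f has_integral ((1 - s) * b powr s)) {s..1}"
      by (rule has_integral_spike_finite[of "{}", rotated 2]) (use b in \<open>auto simp: min_def\<close>)
    then show ?thesis
      using has_integral_combine[OF _ _ below[OF s order_refl], of 1] False s
      by (simp add: growth_integral_def)
  qed
qed

text \<open>Expected delay that jobs of sizes \<open>x\<close> and \<open>x * b powr s\<close> cause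
  each other, divided by \<open>x\<close>. The term \<open>2 / ln b\<close> stems from the probings
  before the final round of the smaller job.\<close>

definition pair_ratio :: "real \<Rightarrow> real \<Rightarrow> real" where
  "pair_ratio b s = 2 / ln b + 1 / 2 + growth_integral b s / 2"

text \<open>The integrand of \<open>growth_integral\<close> is pointwise increasing in \<open>s\<close>.\<close>

lemma pair_ratio_mono:
  assumes b: "b > 1" and s: "0 \<le> s" "s \<le> t"
  shows "pair_ratio b s \<le> pair_ratio b t"
proof -
  have "0 \<le> t" using s by simp
  have st: "b powr s \<le> b powr t" using b s by simp
  have "growth_integral b s \<le> growth_integral b t"
    by (rule has_integral_le[OF has_integral_growth[OF b s(1)] has_integral_growth[OF b \<open>0 \<le> t\<close>]])
       (use st in \<open>auto simp: min_def\<close>)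
  then show ?thesis by (simp add: pair_ratio_def)
qed

text \<open>Delay that a job of size \<open>y\<close> causes one of size \<open>x\<close>, averaged
  over an order and its reversal: in the final round of \<open>x\<close>, job \<open>y\<close> comes
  first in only one of them.\<close>

definition pair_work :: "real \<Rightarrow> real \<Rightarrow> real \<Rightarrow> real \<Rightarrow> real" where
  "pair_work b \<xi> x y = work_before b \<xi> y (final_round b \<xi> x) + work_in b \<xi> y (final_round b \<xi> x) / 2"

text \<open>Before the final round of the smaller job both are only aborted, giving two equal
  geometric sums. The run of \<open>x\<close> delays \<open>y\<close> in full if \<open>y\<close>
  needs a later round, and by half if both finish in the same round.\<close>

lemma pair_work_sum:
  assumes b: "b > 1" and x: "0 < x" "x \<le> y"
  shows "pair_work b \<xi> x y + pair_work b \<xi> y x =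
    2 * probe_time b \<xi> (final_round b \<xi> x) / (b - 1) + x / 2
    + (if probe_time b \<xi> (final_round b \<xi> x) < y then x else 0) / 2
    + min y (probe_time b \<xi> (final_round b \<xi> x)) / 2"
proof -
  let ?q = "final_round b \<xi> x" and ?r = "final_round b \<xi> y"
  have y: "0 < y" using x by simp
  have qr: "?q \<le> ?r" using final_round_mono[OF b x] .
  have less: "probe_time b \<xi> ?q < y \<longleftrightarrow> ?q < ?r"
    using le_probe_time_iff[OF b y, of \<xi> ?q] by linarith
  have xq: "x \<le> probe_time b \<xi> ?r" using le_probe_time_iff[OF b x(1)] qr by simp
  show ?thesis
  proof (cases "?q < ?r")
    case True
    then show ?thesis using less qr by (simp add: pair_work_def work_before_def work_in_def)
  next
    case False
    then have "?r = ?q" using qr by simp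
    then show ?thesis using less xq by (simp add: pair_work_def work_before_def work_in_def)
  qed
qed

lemma has_integral_probe_time_final_round:
  assumes b: "b > 1" and x: "0 < x"
  shows "((\<lambda>\<xi>. probe_time b \<xi> (final_round b \<xi> x)) has_integral (x * (b - 1) / ln b)) {0..1}"
proof -
  have "((\<lambda>u. b powr u) has_integral (b - 1) / ln b) {0..1}"
    using has_integral_powr[OF b, of 0 1] b by (simp add: diff_divide_distrib)
  from has_integral_mult_right[OF has_integral_frac_shift[OF this, of "log b x"], of x]
  show ?thesis unfolding probe_time_final_round[OF b x] by simp
qed

text \<open>With \<open>u = frac (\<xi> - log b x)\<close> every term of
  \<open>pair_work_sum\<close> is \<open>x\<close> times a function of \<open>u\<close> and
  \<open>s\<close>, and passing to \<open>u\<close> preserves the integral.\<close>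

lemma has_integral_pair_work:
  assumes b: "b > 1" and x: "0 < x" and s: "0 \<le> s"
  defines "y \<equiv> x * b powr s"
  shows "((\<lambda>\<xi>. pair_work b \<xi> x y + pair_work b \<xi> y x) has_integral (x * pair_ratio b s)) {0..1}"
proof -
  have "1 \<le> b powr s" using b s by (simp add: ge_one_powr_ge_zero)
  then have xy: "x \<le> y" using x by (simp add: y_def)
  let ?X = "\<lambda>\<xi>. probe_time b \<xi> (final_round b \<xi> x)"
  let ?U = "\<lambda>\<xi>. frac (\<xi> - log b x)"
  have "((\<lambda>\<xi>. 2 / (b - 1) * ?X \<xi> + x / 2 + x / 2 * ((if b powr ?U \<xi> < b powr s then 1 else 0)
      + min (b powr s) (b powr ?U \<xi>)))
      has_integral (2 / (b - 1) * (x * (b - 1) / ln b) + x / 2 + x / 2 * growth_integral b s)) {0..1}"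
    using has_integral_const_real[of "x / 2" 0 1]
    by (intro has_integral_add has_integral_mult_right has_integral_probe_time_final_round b x
        has_integral_frac_shift[OF has_integral_growth[OF b s]]) simp
  moreover have "2 / (b - 1) * ?X \<xi> + x / 2 + x / 2 * ((if b powr ?U \<xi> < b powr s then 1 else 0)
      + min (b powr s) (b powr ?U \<xi>)) = pair_work b \<xi> x y + pair_work b \<xi> y x" for \<xi>
  proof -
    have "?X \<xi> < y \<longleftrightarrow> b powr ?U \<xi> < b powr s"
      unfolding probe_time_final_round[OF b x] y_def using x by simp
    moreover have "min y (?X \<xi>) = x * min (b powr s) (b powr ?U \<xi>)"
      unfolding probe_time_final_round[OF b x] y_def using x by (simp add: min_mult_distrib_left)
    ultimately show ?thesis
      unfolding pair_work_sum[OF b x xy] by (cases "?X \<xi> < y") (simp_all add: distrib_left)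
  qed
  moreover have "2 / (b - 1) * (x * (b - 1) / ln b) + x / 2 + x / 2 * growth_integral b s = x * pair_ratio b s"
    using b by (simp add: pair_ratio_def distrib_left)
  ultimately show ?thesis by (simp only:)
qed

lemma sum_pairs:
  fixes T :: "nat \<Rightarrow> nat \<Rightarrow> real"
  shows "(\<Sum>j<n. \<Sum>k<n. T j k) = (\<Sum>j<n. T j j + (\<Sum>i<j. T j i + T i j))"
  by (induction n) (simp_all add: sum.distrib)

lemma mean_cost_pairs:
  assumes b: "b > 1" and pos: "\<forall>x\<in>set p. 0 < x"
  shows "mean_cost b \<xi> p = (\<Sum>j<length p. probe_time b \<xi> (final_round b \<xi> (p ! j)) / (b - 1) + p ! j
      + (\<Sum>i<j. pair_work b \<xi> (p ! j) (p ! i) + pair_work b \<xi> (p ! i) (p ! j)))"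
proof -
  let ?n = "length p"
  let ?B = "\<lambda>j k. work_before b \<xi> (p ! k) (final_round b \<xi> (p ! j))"
  let ?W = "\<lambda>j k. work_in b \<xi> (p ! k) (final_round b \<xi> (p ! j))"
  \<comment> \<open>\<open>mean_cost\<close> excludes \<open>k = j\<close> from the halved sum and
    adds \<open>p ! j\<close>; the diagonal term corrects \<open>pair_work\<close> for both.\<close>
  let ?T = "\<lambda>j k. pair_work b \<xi> (p ! j) (p ! k) + (if j = k then p ! j - ?W j j / 2 else 0)"
  have "(\<Sum>k<?n. ?B j k) + (\<Sum>k\<in>{..<?n} - {j}. ?W j k) / 2 + p ! j = (\<Sum>k<?n. ?T j k)" if "j < ?n" for j
  proof -
    have "(\<Sum>k\<in>{..<?n} - {j}. ?W j k) = (\<Sum>k<?n. ?W j k) - ?W j j"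
      using that by (simp add: sum_diff1)
    moreover have "(\<Sum>k<?n. if j = k then p ! j - ?W j j / 2 else 0) = p ! j - ?W j j / 2"
      using that by simp
    ultimately show ?thesis
      by (simp only: pair_work_def sum.distrib sum_divide_distrib[symmetric] diff_divide_distrib)
  qed
  then have "mean_cost b \<xi> p = (\<Sum>j<?n. \<Sum>k<?n. ?T j k)"
    unfolding mean_cost_def by (intro sum.cong) auto
  also have "\<dots> = (\<Sum>j<?n. ?T j j + (\<Sum>i<j. ?T j i + ?T i j))"
    by (rule sum_pairs)
  also have "\<dots> = (\<Sum>j<?n. probe_time b \<xi> (final_round b \<xi> (p ! j)) / (b - 1) + p ! j
      + (\<Sum>i<j. pair_work b \<xi> (p ! j) (p ! i) + pair_work b \<xi> (p ! i) (p ! j)))"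
  proof (intro sum.cong refl)
    fix j
    have "?T j j = probe_time b \<xi> (final_round b \<xi> (p ! j)) / (b - 1) + p ! j"
      by (simp add: pair_work_def work_before_def)
    moreover have "(\<Sum>i<j. ?T j i + ?T i j) =
        (\<Sum>i<j. pair_work b \<xi> (p ! j) (p ! i) + pair_work b \<xi> (p ! i) (p ! j))"
      by (intro sum.cong) auto
    ultimately show "?T j j + (\<Sum>i<j. ?T j i + ?T i j) =
        probe_time b \<xi> (final_round b \<xi> (p ! j)) / (b - 1) + p ! j
        + (\<Sum>i<j. pair_work b \<xi> (p ! j) (p ! i) + pair_work b \<xi> (p ! i) (p ! j))"
      by (simp only:)
  qed
  finally show ?thesis .
qed

text \<open>In a pair \<open>i < j\<close> job \<open>j\<close> is the smaller one, so
  \<open>p ! j\<close> factors out. The summand \<open>1 / ln b + 1\<close> accounts for its own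
  aborted probings and its run.\<close>

lemma R_expected_decreasing:
  assumes b: "b > 1" and pos: "\<forall>x\<in>set p. 0 < x"
    and s: "\<And>i j. i < j \<Longrightarrow> j < length p \<Longrightarrow> 0 \<le> s i j \<and> p ! i = p ! j * b powr s i j"
  shows "R_expected b p = (\<Sum>j<length p. p ! j * (1 / ln b + 1 + (\<Sum>i<j. pair_ratio b (s i j))))"
proof (rule R_expected_eq[OF b pos])
  have p: "0 < p ! k" if "k < length p" for k using pos that by simp
  have "((\<lambda>\<xi>. \<Sum>j<length p. probe_time b \<xi> (final_round b \<xi> (p ! j)) / (b - 1) + p ! j
      + (\<Sum>i<j. pair_work b \<xi> (p ! j) (p ! i) + pair_work b \<xi> (p ! i) (p ! j)))
    has_integral (\<Sum>j<length p. p ! j * (b - 1) / ln b / (b - 1) + p ! j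
      + (\<Sum>i<j. p ! j * pair_ratio b (s i j)))) {0..1}"
  proof (intro has_integral_sum has_integral_add has_integral_divide has_integral_probe_time_final_round b)
    fix i j assume "j \<in> {..<length p}" "i \<in> {..<j}"
    then show "((\<lambda>\<xi>. pair_work b \<xi> (p ! j) (p ! i) + pair_work b \<xi> (p ! i) (p ! j))
      has_integral p ! j * pair_ratio b (s i j)) {0..1}"
      using has_integral_pair_work[OF b p, of j "s i j"] s[of i j] by simp
  next
    show "((\<lambda>\<xi>::real. p ! j) has_integral p ! j) {0..1}" for j
      using has_integral_const_real[of "p ! j" 0 1] by simp
  qed (use p in auto)
  moreover have "(\<Sum>j<length p. p ! j * (b - 1) / ln b / (b - 1) + p ! j
      + (\<Sum>i<j. p ! j * pair_ratio b (s i j))) =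
      (\<Sum>j<length p. p ! j * (1 / ln b + 1 + (\<Sum>i<j. pair_ratio b (s i j))))"
    using b by (intro sum.cong refl) (simp add: distrib_left sum_distrib_left)
  ultimately show "((\<lambda>\<xi>. mean_cost b \<xi> p) has_integral
     (\<Sum>j<length p. p ! j * (1 / ln b + 1 + (\<Sum>i<j. pair_ratio b (s i j))))) {0..1}"
    unfolding mean_cost_pairs[OF b pos] by simp
qed

section \<open>Weighted means and Riemann sums\<close>

text \<open>Cesaro argument: from \<open>N\<close> on the terms are within \<open>e / 2\<close> of
  \<open>l\<close>, and the fixed contribution \<open>K\<close> of the earlier ones is outweighed by
  the divergent total weight.\<close>

lemma weighted_means_tendsto:
  fixes w f :: "nat \<Rightarrow> real"
  assumes w: "\<And>k. w k > 0" "filterlim (\<lambda>n. \<Sum>k<n. w k) at_top sequentially"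
    and f: "f \<longlonglongrightarrow> l"
  shows "(\<lambda>n. (\<Sum>k<n. w k * f k) / (\<Sum>k<n. w k)) \<longlonglongrightarrow> l"
proof (rule LIMSEQ_I)
  fix e :: real assume e: "e > 0"
  obtain N where N: "\<And>k. k \<ge> N \<Longrightarrow> \<bar>f k - l\<bar> < e / 2"
    using LIMSEQ_D[OF f, of "e / 2"] e by auto
  define K where "K = (\<Sum>k<N. w k * \<bar>f k - l\<bar>)"
  \<comment> \<open>A total weight above \<open>2 * K / e\<close> keeps \<open>K\<close> below
    \<open>e / 2\<close> times that weight.\<close>
  have "\<forall>\<^sub>F n in sequentially. (\<Sum>k<n. w k) > max 0 (2 * K / e)"
    using w(2) unfolding filterlim_at_top_dense by blast
  then obtain M where M: "\<And>n. n \<ge> M \<Longrightarrow> (\<Sum>k<n. w k) > max 0 (2 * K / e)"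
    by (auto simp: eventually_sequentially)
  have "\<bar>(\<Sum>k<n. w k * f k) / (\<Sum>k<n. w k) - l\<bar> < e" if n: "n \<ge> max M N" for n
  proof -
    let ?W = "\<Sum>k<n. w k"
    have W: "?W > 0" "?W > 2 * K / e" using M[of n] n by auto
    have "(\<Sum>k<n. w k * f k) / ?W - l = (\<Sum>k<n. w k * (f k - l)) / ?W"
      using W by (simp add: field_simps sum_subtractf sum_distrib_left)
    moreover have "\<bar>\<Sum>k<n. w k * (f k - l)\<bar> \<le> K + e / 2 * ?W"
    proof -
      have "\<bar>\<Sum>k<n. w k * (f k - l)\<bar> \<le> (\<Sum>k<n. w k * \<bar>f k - l\<bar>)"
        using w(1) by (intro order.trans[OF sum_abs] sum_mono) (simp add: abs_mult less_imp_le)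
      also have "\<dots> = K + (\<Sum>k\<in>{N..<n}. w k * \<bar>f k - l\<bar>)"
        using n unfolding K_def by (simp add: lessThan_atLeast0 sum.atLeastLessThan_concat)
      also have "(\<Sum>k\<in>{N..<n}. w k * \<bar>f k - l\<bar>) \<le> (\<Sum>k\<in>{N..<n}. w k * (e / 2))"
        using w(1) N by (intro sum_mono mult_left_mono) (auto simp: less_imp_le)
      also have "\<dots> \<le> (\<Sum>k<n. w k * (e / 2))"
        using w(1) e by (intro sum_mono2) (auto simp: less_imp_le)
      also have "(\<Sum>k<n. w k * (e / 2)) = ?W * (e / 2)" by (rule sum_distrib_right[symmetric])
      finally show ?thesis by (simp add: mult.commute)
    qed
    moreover have "K + e / 2 * ?W < e * ?W"
      using W e by (simp add: field_simps)
    ultimately show ?thesis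
      using W by (simp add: pos_divide_less_eq)
  qed
  then show "\<exists>no. \<forall>n\<ge>no. norm ((\<Sum>k<n. w k * f k) / (\<Sum>k<n. w k) - l) < e"
    unfolding real_norm_def by blast
qed

text \<open>By monotonicity the sum lies between the integrals over \<open>[1 / (k + 1), 1]\<close>
  (left endpoints) and \<open>[0, k / (k + 1)]\<close> (right endpoints). Continuity of the
  indefinite integral \<open>H\<close> closes the gap of one cell.\<close>

lemma antimono_riemann_sum:
  fixes f :: "real \<Rightarrow> real"
  assumes anti: "\<And>x y. 0 \<le> x \<Longrightarrow> x \<le> y \<Longrightarrow> y \<le> 1 \<Longrightarrow> f y \<le> f x"
    and I: "(f has_integral I) {0..1}"
  shows "(\<lambda>k. (\<Sum>i<k. f (real (Suc i) / real (Suc k))) / real (Suc k)) \<longlonglongrightarrow> I"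
proof -
  define H where "H = (\<lambda>x. integral {0..x} f)"
  have f: "f integrable_on {0..1}" using I by blast
  have H01: "H 0 = 0" "H 1 = I" using I by (auto simp: H_def)
  have step: "(y - x) * f y \<le> H y - H x" "H y - H x \<le> (y - x) * f x"
    if "0 \<le> x" "x \<le> y" "y \<le> 1" for x y
  proof -
    have xy: "(f has_integral (H y - H x)) {x..y}"
    proof -
      have "f integrable_on {0..y}" "f integrable_on {x..y}"
        using that by (auto intro!: integrable_subinterval_real[OF f])
      then show ?thesis
        using Henstock_Kurzweil_Integration.integral_combine[of 0 x y f] that unfolding H_def by (simp add: has_integral_iff)
    qed
    have c: "((\<lambda>_. c) has_integral (y - x) * c) {x..y}" for c :: real
      using has_integral_const_real[of c x y] that by simp
    show "(y - x) * f y \<le> H y - H x" "H y - H x \<le> (y - x) * f x"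
      using that by (auto intro!: has_integral_le[OF c xy] has_integral_le[OF xy c] anti)
  qed
  have cont: "continuous_on {0..1} H"
    unfolding H_def by (rule indefinite_integral_continuous_1[OF f])
  let ?S = "\<lambda>k. (\<Sum>i<k. f (real (Suc i) / real (Suc k))) / real (Suc k)"
  have upper: "?S k \<le> H (real k / real (Suc k)) - H 0" for k
  proof -
    let ?x = "\<lambda>i. real i / real (Suc k)"
    have "?S k = (\<Sum>i<k. (?x (Suc i) - ?x i) * f (?x (Suc i)))"
      by (simp add: sum_divide_distrib flip: diff_divide_distrib)
    also have "\<dots> \<le> (\<Sum>i<k. H (?x (Suc i)) - H (?x i))"
      by (intro sum_mono step) (auto intro!: divide_right_mono)
    also have "\<dots> = H (?x k) - H (?x 0)" by (rule sum_lessThan_telescope)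
    finally show ?thesis by simp
  qed
  have lower: "H 1 - H (1 / real (Suc k)) \<le> ?S k" for k
  proof -
    let ?x = "\<lambda>i. real (Suc i) / real (Suc k)"
    have "H 1 - H (1 / real (Suc k)) = H (?x k) - H (?x 0)" by simp
    also have "\<dots> = (\<Sum>i<k. H (?x (Suc i)) - H (?x i))"
      by (rule sum_lessThan_telescope[symmetric])
    also have "\<dots> \<le> (\<Sum>i<k. (?x (Suc i) - ?x i) * f (?x i))"
      by (intro sum_mono step) (auto intro!: divide_right_mono)
    also have "\<dots> = ?S k"
      by (simp add: sum_divide_distrib flip: diff_divide_distrib)
    finally show ?thesis .
  qed
  have "(\<lambda>k. H (real k / real (Suc k))) \<longlonglongrightarrow> H 1"
    using LIMSEQ_n_over_Suc_n[where 'a = real]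
    by (intro continuous_on_tendsto_compose[OF cont]) (auto simp: divide_le_eq_1)
  then have up: "(\<lambda>k. H (real k / real (Suc k)) - H 0) \<longlonglongrightarrow> I"
    using H01 by simp
  have "(\<lambda>k. H (1 / real (Suc k))) \<longlonglongrightarrow> H 0"
    using LIMSEQ_inverse_real_of_nat
    by (intro continuous_on_tendsto_compose[OF cont]) (auto simp: inverse_eq_divide)
  then have lo: "(\<lambda>k. H 1 - H (1 / real (Suc k))) \<longlonglongrightarrow> I"
    using H01 tendsto_diff[OF tendsto_const, of _ 0 sequentially I] by auto
  show ?thesis
    by (rule tendsto_sandwich[OF _ _ lo up]) (use lower upper in auto)
qed

section \<open>The instances\<close>

text \<open>The value at \<open>0\<close> is the limit from the right; the junk value \<open>log b 0 = 0\<close> would break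
  monotonicity.\<close>

definition inv_sq_ratio :: "real \<Rightarrow> real \<Rightarrow> real" where
  "inv_sq_ratio b u = pair_ratio b (if u = 0 then 1 else - 2 * log b u)"

text \<open>For \<open>u > 0\<close> the argument \<open>- 2 * log b u\<close> falls as
  \<open>u\<close> grows. At \<open>u = 0\<close> the value is the maximum of
  \<open>pair_ratio\<close>, which is attained from \<open>s = 1\<close> on.\<close>

lemma inv_sq_ratio_antimono:
  assumes b: "b > 1" and uv: "0 \<le> u" "u \<le> v" "v \<le> 1"
  shows "inv_sq_ratio b v \<le> inv_sq_ratio b u"
proof (cases "u = 0")
  case True
  have le1: "pair_ratio b t \<le> pair_ratio b 1" if "0 \<le> t" for t
  proof (cases "t \<le> 1")
    case True
    then show ?thesis by (rule pair_ratio_mono[OF b that])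
  qed (simp add: pair_ratio_def growth_integral_def)
  have "0 \<le> (if v = 0 then 1 else - 2 * log b v)"
    using uv b by (auto simp: log_le_zero_cancel_iff)
  then show ?thesis
    using le1 unfolding inv_sq_ratio_def True by simp
next
  case False
  then have "log b u \<le> log b v" "log b v \<le> 0" using b uv by auto
  then show ?thesis
    using False uv by (auto simp: inv_sq_ratio_def intro!: pair_ratio_mono b)
qed

lemma has_integral_inv_sq_ratio:
  assumes b: "b > 1"
  shows "(inv_sq_ratio b has_integral (sqrt b + 2 * b - 1) / (sqrt b * ln b)) {0..1}"
proof -
  define L where "L = ln b"
  define r where "r = sqrt b"
  have L: "L > 0" using b by (simp add: L_def)
  have r: "r > 1" "r\<^sup>2 = b" using b by (simp_all add: r_def)
  have lnr: "ln r = L / 2" using b by (simp add: r_def L_def ln_sqrt)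
  \<comment> \<open>At this point \<open>- 2 * log b u\<close> equals 1, so
    \<open>growth_integral\<close> changes branch here.\<close>
  define c where "c = 1 / r"
  have c: "0 < c" "c \<le> 1" using r by (simp_all add: c_def)
  have lnc: "ln c = - L / 2" using r lnr by (simp add: c_def ln_div)
  define A where "A = 2 / L + 1 / 2 + (1 + (b - 1) / L) / 2"
  have left: "(inv_sq_ratio b has_integral (c * A)) {0..c}"
  proof -
    have "inv_sq_ratio b u = A" if u: "u \<in> {0..c}" for u
    proof (cases "u = 0")
      case False
      then have "ln u \<le> - L / 2" using u c unfolding lnc[symmetric] by simp
      then have "- 2 * log b u \<ge> 1"
        using L by (simp add: log_def field_simps flip: L_def)
      then show ?thesis
        using False by (simp add: inv_sq_ratio_def pair_ratio_def growth_integral_def A_def L_def)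
    qed (simp add: inv_sq_ratio_def pair_ratio_def growth_integral_def A_def L_def)
    moreover have "((\<lambda>u. A) has_integral c * A) {0..c}"
      using has_integral_const_real[of A 0 c] c by simp
    ultimately show ?thesis
      by (subst has_integral_cong[where g = "\<lambda>u. A"]) auto
  qed
  \<comment> \<open>Antiderivative for the second branch with \<open>s = - 2 * ln u / L\<close> and
    \<open>b powr s = 1 / u\<^sup>2\<close>; its last summand uses that
    \<open>- (ln u + 1) / u\<close> has derivative \<open>ln u / u\<^sup>2\<close>.\<close>
  define \<Phi> where "\<Phi> = (\<lambda>u. (2 / L + 1 / 2) * u +
    (- 2 * (u * ln u - u) / L + (- 1 / u - u) / L - 1 / u - 2 / L * ((ln u + 1) / u)) / 2)"
  have right: "(inv_sq_ratio b has_integral (\<Phi> 1 - \<Phi> c)) {c..1}"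
  proof (rule fundamental_theorem_of_calculus[OF c(2)])
    fix u assume u: "u \<in> {c..1}"
    then have u0: "u > 0" using c by simp
    have "- L / 2 \<le> ln u" using u c u0 unfolding lnc[symmetric] by simp
    then have s1: "- 2 * log b u \<le> 1"
      using L by (simp add: log_def field_simps flip: L_def)
    have "b powr (- 2 * log b u) = (b powr log b u) powr (- 2)"
      by (simp add: powr_powr mult.commute)
    also have "\<dots> = 1 / u\<^sup>2"
      using b u0 by (simp add: powr_minus inverse_eq_divide)
    finally have pw: "b powr (- 2 * log b u) = 1 / u\<^sup>2" .
    \<comment> \<open>At \<open>s = 1\<close> both branches give \<open>1 + (b - 1) / L\<close>, so
      the second formula covers the endpoint.\<close>
    have gi: "growth_integral b s = s + (b powr s - 1) / L + (1 - s) * b powr s" if "s \<le> 1" for s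
      using that b by (cases "s = 1") (auto simp: growth_integral_def L_def)
    have "inv_sq_ratio b u = 2 / L + 1 / 2 +
        (- 2 * ln u / L + (1 / u\<^sup>2 - 1) / L + (1 + 2 * ln u / L) * (1 / u\<^sup>2)) / 2"
    proof -
      have "growth_integral b (- 2 * log b u) =
          - 2 * ln u / L + (1 / u\<^sup>2 - 1) / L + (1 + 2 * ln u / L) * (1 / u\<^sup>2)"
        unfolding gi[OF s1] pw by (simp add: log_def L_def)
      then show ?thesis
        using u0 unfolding inv_sq_ratio_def pair_ratio_def L_def[symmetric] by simp
    qed
    moreover have "(\<Phi> has_real_derivative (2 / L + 1 / 2 +
        (- 2 * ln u / L + (1 / u\<^sup>2 - 1) / L + (1 + 2 * ln u / L) * (1 / u\<^sup>2)) / 2)) (at u)"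
      unfolding \<Phi>_def using u0 L
      by (auto intro!: derivative_eq_intros simp: field_simps power2_eq_square)
    ultimately show "(\<Phi> has_vector_derivative inv_sq_ratio b u) (at u within {c..1})"
      by (simp add: has_real_derivative_iff_has_vector_derivative has_vector_derivative_at_within)
  qed
  have "c * A + (\<Phi> 1 - \<Phi> c) = (r + 2 * b - 1) / (r * L)"
    unfolding \<Phi>_def lnc A_def unfolding c_def using L r(1)
    by (simp add: r(2)[symmetric] field_simps power2_eq_square)
  then show ?thesis
    using has_integral_combine[OF _ c(2) left right] c by (simp add: r_def L_def)
qed

section \<open>Optimum and expected cost of the inverse-square jobs\<close>

lemma list_cost_rev_map:
  "list_cost (rev (map f [0..<n])) = (\<Sum>k<n. real (Suc k) * f k)"
  by (induction n) (simp_all add: list_cost_Cons algebra_simps)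

definition inv_sq_jobs :: "nat \<Rightarrow> real list" where
  "inv_sq_jobs n = map (\<lambda>k. 1 / (real (Suc k))\<^sup>2) [0..<n]"

lemma inv_sq_jobs_pos: "\<forall>x\<in>set (inv_sq_jobs n). 0 < x"
  by (auto simp: inv_sq_jobs_def)

text \<open>The reversed list is sorted, and there the job \<open>1 / (k + 1)\<^sup>2\<close> has
  \<open>k\<close> jobs behind it, so it counts \<open>k + 1\<close> times.\<close>

lemma OPT_inv_sq_jobs:
  assumes "n > 0"
  shows "OPT (inv_sq_jobs n) = (\<Sum>k<n. 1 / real (Suc k))"
proof -
  have "is_instance (inv_sq_jobs n)"
    using assms inv_sq_jobs_pos[of n] by (simp add: is_instance_def inv_sq_jobs_def)
  moreover have "sort (inv_sq_jobs n) = rev (inv_sq_jobs n)"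
  proof (rule properties_for_sort)
    have "sorted_wrt (\<ge>) (inv_sq_jobs n)"
      by (auto simp: inv_sq_jobs_def sorted_wrt_iff_nth_less intro!: divide_left_mono power_mono)
    then show "sorted (rev (inv_sq_jobs n))"
      by (simp add: sorted_wrt_rev)
  qed simp
  ultimately have "OPT (inv_sq_jobs n) = list_cost (rev (inv_sq_jobs n))"
    by (simp add: OPT_eq_nondecreasing_order list_cost_def)
  also have "\<dots> = (\<Sum>k<n. 1 / real (Suc k))"
    unfolding inv_sq_jobs_def list_cost_rev_map
    by (intro sum.cong) (simp_all add: power2_eq_square del: of_nat_Suc)
  finally show ?thesis .
qed

text \<open>Jobs \<open>i < j\<close> have size ratio \<open>1 / u\<^sup>2\<close> with
  \<open>u = (i + 1) / (j + 1)\<close>. The size \<open>1 / (j + 1)\<^sup>2\<close> splits into the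
  weight \<open>1 / (j + 1)\<close> and the Riemann step \<open>1 / (j + 1)\<close>.\<close>

lemma R_expected_inv_sq_jobs:
  assumes b: "b > 1"
  shows "R_expected b (inv_sq_jobs n) = (\<Sum>k<n. 1 / real (Suc k) *
    ((1 / ln b + 1) / real (Suc k)
     + (\<Sum>i<k. inv_sq_ratio b (real (Suc i) / real (Suc k))) / real (Suc k)))"
proof -
  let ?s = "\<lambda>i j. - 2 * log b (real (Suc i) / real (Suc j))"
  have s: "0 \<le> ?s i j \<and> inv_sq_jobs n ! i = inv_sq_jobs n ! j * b powr ?s i j"
    if "i < j" "j < length (inv_sq_jobs n)" for i j
  proof -
    let ?u = "real (Suc i) / real (Suc j)"
    have u: "0 < ?u" "?u \<le> 1" using that by auto
    have "b powr ?s i j = (b powr log b ?u) powr (- 2)"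
      unfolding powr_powr by (simp only: mult.commute)
    also have "\<dots> = 1 / ?u\<^sup>2"
      using b u(1) by (simp add: powr_minus inverse_eq_divide del: of_nat_Suc)
    finally have pw: "b powr ?s i j = 1 / ?u\<^sup>2" .
    have "inv_sq_jobs n ! i = inv_sq_jobs n ! j * (1 / ?u\<^sup>2)"
      using that by (simp add: inv_sq_jobs_def power_divide del: of_nat_Suc)
    moreover have "log b ?u \<le> 0" using u b by (simp del: of_nat_Suc)
    ultimately show ?thesis unfolding pw by linarith
  qed
  have "R_expected b (inv_sq_jobs n) = (\<Sum>j<n. inv_sq_jobs n ! j *
      (1 / ln b + 1 + (\<Sum>i<j. pair_ratio b (?s i j))))"
    using R_expected_decreasing[OF b inv_sq_jobs_pos s] by (simp add: inv_sq_jobs_def)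
  also have "\<dots> = (\<Sum>k<n. 1 / real (Suc k) *
    ((1 / ln b + 1) / real (Suc k)
     + (\<Sum>i<k. inv_sq_ratio b (real (Suc i) / real (Suc k))) / real (Suc k)))"
    \<comment> \<open>All arguments are positive here, so the special branch of
      \<open>inv_sq_ratio\<close> at 0 is never taken.\<close>
    by (intro sum.cong)
       (simp_all add: inv_sq_jobs_def inv_sq_ratio_def power2_eq_square add_divide_distrib
         del: of_nat_Suc)
  finally show ?thesis .
qed

theorem theorem1p5:
  fixes b :: real
  assumes "b > 1"
  shows "\<exists>p :: nat \<Rightarrow> real list.
           (\<forall>i. is_instance (p i)) \<and>
           (\<lambda>i. R_expected b (p i) / OPT (p i))
             \<longlonglongrightarrow> (sqrt b + 2 * b - 1) / (sqrt b * ln b)"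
proof (intro exI[of _ "\<lambda>i. inv_sq_jobs (Suc i)"] conjI allI)
  \<comment> \<open>The index is shifted because the empty list is not an instance.\<close>
  show "is_instance (inv_sq_jobs (Suc i))" for i
    using inv_sq_jobs_pos[of "Suc i"] by (simp add: is_instance_def inv_sq_jobs_def)
  let ?f = "\<lambda>k. (1 / ln b + 1) / real (Suc k)
     + (\<Sum>i<k. inv_sq_ratio b (real (Suc i) / real (Suc k))) / real (Suc k)"
  let ?l = "(sqrt b + 2 * b - 1) / (sqrt b * ln b)"
  have "(\<lambda>k. (1 / ln b + 1) / real (Suc k)) \<longlonglongrightarrow> 0"
    using tendsto_mult_right_zero[OF LIMSEQ_inverse_real_of_nat, of "1 / ln b + 1"]
    by (simp add: divide_inverse)
  from tendsto_add[OF this antimono_riemann_sum[OF inv_sq_ratio_antimono[OF assms]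
      has_integral_inv_sq_ratio[OF assms]]]
  have f: "?f \<longlonglongrightarrow> ?l" by simp
  \<comment> \<open>The total weight, which is also the optimum, is a harmonic number and hence
    diverges.\<close>
  have "filterlim (\<lambda>n. \<Sum>k<n. 1 / real (Suc k)) at_top sequentially"
  proof -
    have "harm n = (\<Sum>k<n. 1 / real (Suc k))" for n
      by (induction n) (simp_all add: harm_Suc harm_expand(1) inverse_eq_divide)
    then have "harm = (\<lambda>n. \<Sum>k<n. 1 / real (Suc k))" by (rule ext)
    then show ?thesis using harm_at_top by metis
  qed
  from weighted_means_tendsto[OF _ this f]
  have "(\<lambda>n. (\<Sum>k<n. 1 / real (Suc k) * ?f k) / (\<Sum>k<n. 1 / real (Suc k))) \<longlonglongrightarrow> ?l"
    by simp
  from LIMSEQ_Suc[OF this]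
  show "(\<lambda>i. R_expected b (inv_sq_jobs (Suc i)) / OPT (inv_sq_jobs (Suc i))) \<longlonglongrightarrow> ?l"
    by (simp only: R_expected_inv_sq_jobs[OF assms] OPT_inv_sq_jobs zero_less_Suc)
qed

end
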